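(* Let $n\geq 2$ be an integer. Then every zero $x$ of the Hermite polynomial $H_n(x)$ satisfies $$|x|\leq \cos\left(\frac{\pi}{n+1}\right)\sqrt{2n-2}.$$
   Context: $H_n$ denotes the $n$th (physicists') Hermite polynomial, $H_n(x)=n!\sum_{k=0}^{\lfloor n/2\rfloor}\frac{(-1)^k}{k!}\frac{(2x)^{n-2k}}{(n-2k)!}$; e.g. $H_0(x)=1$, $H_1(x)=2x$, $H_2(x)=4x^2-2$. *)

theory Defs
  imports Complex_Main "HOL-Computational_Algebra.Polynomial"
begin

text \<open>
  The physicists' Hermite polynomial, over any field of characteristic zero, so that its
  zeros can be taken in \<^typ>\<open>complex\<close> without coercing coefficients. The factor
  \<^term>\<open>[:0, 2:]\<close> is the polynomial \<open>2x\<close>.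
\<close>

definition hermite :: "nat \<Rightarrow> 'a :: field_char_0 poly" where
  "hermite n = smult (fact n)
     (\<Sum>k = 0..n div 2. smult ((-1) ^ k / (fact k * fact (n - 2 * k))) ([:0, 2:] ^ (n - 2 * k)))"

lemma hermite_0: "hermite 0 = 1"
  and hermite_1: "hermite 1 = [:0, 2:]"
  and hermite_2: "hermite 2 = [:-2, 0, 4:]"
  by (simp_all add: hermite_def numeral_2_eq_2)

end

(* Normalised as u_k = H_k(x) / sqrt (2^k k!), the three-term recurrence at a zero x of H_n says
   that x is an eigenvalue of the n by n symmetric tridiagonal matrix with zero diagonal and
   off-diagonal entries sqrt (2k) / 2, k = 1, ..., n - 1. Bounding all these entries by the largest
   one compares |x| with the spectral radius of a multiple of the path matrix, whose Perron
   eigenvector is k |-> sin (k pi / (n + 1)), with eigenvalue 2 cos (pi / (n + 1)). Pairing the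
   vector |u_k| with this positive eigenvector gives the bound. *)
theory Submission
  imports Defs
begin

text \<open>Summand of the Hermite sum with \<open>y\<close> for \<open>2 * x\<close>. The value 0
  past the range lets degrees n, n + 1 and n + 2 share one summation range.\<close>

definition hermite_term :: "'a :: field_char_0 \<Rightarrow> nat \<Rightarrow> nat \<Rightarrow> 'a" where
  "hermite_term y n k =
     (if 2 * k \<le> n then (-1) ^ k * y ^ (n - 2 * k) / (fact k * fact (n - 2 * k)) else 0)"

lemma poly_hermite_eq_sum:
  assumes "n div 2 \<le> N"
  shows "poly (hermite n) x = fact n * (\<Sum>k\<le>N. hermite_term (2 * x) n k)"
proof -
  have "poly (hermite n) x = fact n * (\<Sum>k = 0..n div 2. hermite_term (2 * x) n k)"
    by (auto simp: hermite_def poly_sum hermite_term_def mult.commute intro!: sum.cong)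
  also have "(\<Sum>k = 0..n div 2. hermite_term (2 * x) n k) = (\<Sum>k\<le>N. hermite_term (2 * x) n k)"
    using assms by (intro sum.mono_neutral_left) (auto simp: hermite_term_def)
  finally show ?thesis .
qed

lemma hermite_term_rec_0:
  "of_nat (n + 2) * hermite_term y (n + 2) 0 = y * hermite_term y (n + 1) 0"
proof -
  have "fact (n + 2) = (of_nat (n + 2) * fact (n + 1) :: 'a)"
    by simp
  moreover have "(of_nat (n + 2) :: 'a) \<noteq> 0"
    by (simp only: of_nat_eq_0_iff)
  ultimately show ?thesis
    unfolding hermite_term_def by (simp del: fact_Suc of_nat_Suc of_nat_add)
qed

(* Split the factor n + 2 as (n + 2 - 2 (k + 1)) + 2 (k + 1); each part cancels against one of the
   two factorials. *)
lemma hermite_term_rec_Suc: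
  "of_nat (n + 2) * hermite_term y (n + 2) (Suc k)
     = y * hermite_term y (n + 1) (Suc k) - 2 * hermite_term y n k"
proof (cases "2 * k \<le> n")
  case True
  then obtain m where n: "n = 2 * k + m"
    using le_Suc_ex by blast
  have k: "(of_nat (Suc k) :: 'a) \<noteq> 0"
    by (rule of_nat_neq_0)
  show ?thesis
  \<comment> \<open>For m = 0 the index \<open>Suc k\<close> is out of range in degree n + 1, so the
    first term on the right vanishes.\<close>
  proof (cases m)
    case 0
    show ?thesis
      using k by (simp add: hermite_term_def n 0 divide_simps)
  next
    case (Suc l)
    have l: "(of_nat (Suc l) :: 'a) \<noteq> 0"
      by (rule of_nat_neq_0)
    show ?thesis
      using k l by (simp add: hermite_term_def n Suc divide_simps) (simp add: algebra_simps)
  qed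
next
  case False
  then show ?thesis
    by (simp add: hermite_term_def)
qed

text \<open>Sum the termwise recurrences over a common range, with index 0 split off;
  \<open>fact (n + 2)\<close> supplies the factor n + 2.\<close>

lemma poly_hermite_rec:
  "poly (hermite (n + 2)) x
     = 2 * x * poly (hermite (n + 1)) x - 2 * of_nat (n + 1) * poly (hermite n) x"
proof -
  let ?t = "hermite_term (2 * x)"
  let ?S = "\<lambda>m. \<Sum>k\<le>Suc n. ?t m k"
  have "of_nat (n + 2) * ?S (n + 2)
      = of_nat (n + 2) * ?t (n + 2) 0 + (\<Sum>k\<le>n. of_nat (n + 2) * ?t (n + 2) (Suc k))"
    by (simp only: sum.atMost_Suc_shift distrib_left sum_distrib_left)
  also have "\<dots> = 2 * x * ?t (n + 1) 0 + (\<Sum>k\<le>n. 2 * x * ?t (n + 1) (Suc k) - 2 * ?t n k)"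
    by (simp only: hermite_term_rec_0 hermite_term_rec_Suc)
  also have "\<dots> = 2 * x * ?S (n + 1) - 2 * (\<Sum>k\<le>n. ?t n k)"
    by (simp only: sum.atMost_Suc_shift distrib_left sum_distrib_left sum_subtractf) simp
  finally have rec: "of_nat (n + 2) * ?S (n + 2) = \<dots>" .
  have "poly (hermite (n + 2)) x = fact (n + 1) * (of_nat (n + 2) * ?S (n + 2))"
    by (subst poly_hermite_eq_sum[of _ "Suc n"]) (simp_all add: ac_simps)
  also have "\<dots> = 2 * x * (fact (n + 1) * ?S (n + 1))
      - 2 * of_nat (n + 1) * (fact n * (\<Sum>k\<le>n. ?t n k))"
    unfolding rec by (simp add: algebra_simps)
  also have "fact (n + 1) * ?S (n + 1) = poly (hermite (n + 1)) x"
    by (rule poly_hermite_eq_sum[symmetric]) simp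
  also have "fact n * (\<Sum>k\<le>n. ?t n k) = poly (hermite n) x"
    by (rule poly_hermite_eq_sum[symmetric]) simp
  finally show ?thesis .
qed

text \<open>Summation by parts: the neighbour-sum operator of a path is symmetric up to boundary
  terms, since the difference telescopes to a discrete Wronskian.\<close>

lemma discrete_green:
  fixes f g :: "nat \<Rightarrow> 'a :: comm_ring"
  shows "(\<Sum>k<n. g (Suc k) * (f (k + 2) + f k)) - (\<Sum>k<n. f (Suc k) * (g (k + 2) + g k))
     = (g n * f (Suc n) - f n * g (Suc n)) - (g 0 * f 1 - f 0 * g 1)"
  by (induction n) (simp_all add: algebra_simps)

text \<open>An inequality is assumed instead of an eigenvalue equation because moduli satisfy the
  recurrence only up to the triangle inequality. The path has vertices 1, ..., n; zeros at 0 and n +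
  1 kill the boundary terms of \<open>discrete_green\<close>.\<close>

lemma path_subeigenvalue_le:
  fixes a :: "nat \<Rightarrow> real"
  assumes bnd: "a 0 = 0" "a (Suc n) = 0"
    and nonneg: "\<And>k. a k \<ge> 0" and pos: "j < n" "a (Suc j) > 0"
    and sub: "\<And>k. k < n \<Longrightarrow> r * a (Suc k) \<le> B * (a (k + 2) + a k)"
  shows "r \<le> 2 * B * cos (pi / (real n + 1))"
proof -
  define t where "t = pi / (real n + 1)"
  define s where "s k = sin (real k * t)" for k
  have s0: "s 0 = 0"
    by (simp add: s_def)
  have "real (Suc n) * t = pi"
    by (simp add: t_def field_simps)
  then have sn: "s (Suc n) = 0"
    by (simp only: s_def) simp
  have s_pos: "s (Suc k) > 0" if "k < n" for k
    unfolding s_def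
  proof (rule sin_gt_zero)
    show "0 < real (Suc k) * t"
      by (simp add: t_def)
    have "real (Suc k) * pi < (real n + 1) * pi"
      using that by (intro mult_strict_right_mono) simp_all
    then show "real (Suc k) * t < pi"
      by (simp add: t_def field_simps)
  qed
  have s_rec: "s (k + 2) + s k = 2 * cos t * s (Suc k)" for k
  proof -
    have "real (k + 2) * t = real (Suc k) * t + t" "real k * t = real (Suc k) * t - t"
      by (simp_all add: algebra_simps)
    then show ?thesis
      unfolding s_def by (simp only: sin_add sin_diff) simp
  qed
  let ?P = "\<Sum>k<n. a (Suc k) * s (Suc k)"
  \<comment> \<open>One positive entry makes the whole pairing positive, so it can be cancelled at
    the end.\<close>
  have "0 < a (Suc j) * s (Suc j)"
    using pos s_pos by simp
  also have "\<dots> \<le> ?P"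
    using pos nonneg s_pos by (intro member_le_sum) (auto simp: less_imp_le)
  finally have P: "?P > 0" .
  have "r * ?P = (\<Sum>k<n. s (Suc k) * (r * a (Suc k)))"
    by (simp add: sum_distrib_left ac_simps)
  also have "\<dots> \<le> (\<Sum>k<n. s (Suc k) * (B * (a (k + 2) + a k)))"
    using sub s_pos by (intro sum_mono mult_left_mono) (auto simp: less_imp_le)
  also have "\<dots> = B * (\<Sum>k<n. s (Suc k) * (a (k + 2) + a k))"
    by (simp only: sum_distrib_left ac_simps)
  also have "(\<Sum>k<n. s (Suc k) * (a (k + 2) + a k)) = (\<Sum>k<n. a (Suc k) * (s (k + 2) + s k))"
    using discrete_green[of s a n] s0 sn bnd by simp
  also have "\<dots> = 2 * cos t * ?P"
    unfolding s_rec by (simp only: sum_distrib_left ac_simps)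
  finally have "r * ?P \<le> (2 * B * cos t) * ?P"
    by (simp add: ac_simps)
  then show ?thesis
    using P unfolding t_def by (rule mult_right_le_imp_le)
qed

text \<open>Up to a constant factor, the orthonormal Hermite polynomials for the weight
  exp(-x^2).\<close>

definition hermite_scaled :: "complex \<Rightarrow> nat \<Rightarrow> complex" where
  "hermite_scaled x k = poly (hermite k) x / of_real (sqrt (2 ^ k * fact k))"

lemma hermite_scaled_0 [simp]: "hermite_scaled x 0 = 1"
  by (simp add: hermite_scaled_def hermite_0)

lemma hermite_scaled_1: "x * hermite_scaled x 0 = of_real (sqrt 2 / 2) * hermite_scaled x 1"
proof -
  have "complex_of_real (sqrt 2) * complex_of_real (sqrt 2) = 2"
    by (metis of_real_mult of_real_numeral real_sqrt_mult_self abs_numeral)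
  then show ?thesis
    by (simp add: hermite_scaled_def hermite_0 hermite_1[unfolded One_nat_def])
qed

text \<open>Successive normalisers have ratios \<open>p\<close> and \<open>q\<close>, and
  \<open>p * p\<close> is exactly the coefficient 2 (k + 1) of the unscaled recurrence; dividing by
  \<open>p * d\<close> therefore makes it symmetric.\<close>

lemma hermite_scaled_rec:
  "x * hermite_scaled x (k + 1)
     = of_real (sqrt (2 * (real k + 2)) / 2) * hermite_scaled x (k + 2)
       + of_real (sqrt (2 * (real k + 1)) / 2) * hermite_scaled x k"
proof -
  define d p q where "d = complex_of_real (sqrt (2 ^ k * fact k))"
    and "p = complex_of_real (sqrt (2 * (real k + 1)))"
    and "q = complex_of_real (sqrt (2 * (real k + 2)))"
  have nz: "d \<noteq> 0" "p \<noteq> 0" "q \<noteq> 0"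
    by (simp_all add: d_def p_def q_def)
  have pp: "p * p = of_nat (2 * (k + 1))"
    unfolding p_def by (simp only: flip: of_real_mult) simp
  have d1: "complex_of_real (sqrt (2 ^ (k + 1) * fact (k + 1))) = p * d"
    unfolding d_def p_def by (simp flip: of_real_mult real_sqrt_mult add: algebra_simps)
  have d2: "complex_of_real (sqrt (2 ^ (k + 2) * fact (k + 2))) = q * p * d"
    unfolding d_def p_def q_def by (simp flip: of_real_mult real_sqrt_mult add: algebra_simps)
  have h: "poly (hermite (k + 2)) x
      = 2 * x * poly (hermite (k + 1)) x - p * p * poly (hermite k) x"
    unfolding poly_hermite_rec pp by simp
  show ?thesis
    unfolding hermite_scaled_def d1 d2 h of_real_divide
    unfolding d_def[symmetric] p_def[symmetric] q_def[symmetric]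
    using nz by (simp add: field_simps)
qed

theorem corollary3p1:
  fixes n :: nat and x :: complex
  assumes "n \<ge> 2" and "poly (hermite n) x = 0"
  shows "norm x \<le> cos (pi / (real n + 1)) * sqrt (2 * real n - 2)"
proof -
  define B where "B = sqrt (2 * real n - 2) / 2"
  \<comment> \<open>The shift by one makes room for the boundary value 0 in front of degree 0; the
    other one, at n + 1, is the zero of the polynomial.\<close>
  define a where "a k = (case k of 0 \<Rightarrow> 0 | Suc j \<Rightarrow> norm (hermite_scaled x j))" for k
  have a_n: "hermite_scaled x n = 0"
    using assms(2) by (simp add: hermite_scaled_def)
  \<comment> \<open>For m = n the coefficient exceeds \<open>B\<close>, but there the scaled value
    vanishes.\<close>
  have B: "sqrt (2 * real m) / 2 * norm (hermite_scaled x m) \<le> B * norm (hermite_scaled x m)"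
    if "m \<le> n" for m
  proof (cases "m = n")
    case False
    with that have "sqrt (2 * real m) \<le> sqrt (2 * real n - 2)"
      by simp
    then show ?thesis
      unfolding B_def by (intro mult_right_mono) simp_all
  qed (simp add: a_n)
  have sub: "norm x * a (Suc k) \<le> B * (a (k + 2) + a k)" if "k < n" for k
  proof (cases k)
    case 0
    have "norm x * a (Suc 0) = norm (x * hermite_scaled x 0)"
      by (simp add: a_def)
    also have "\<dots> = sqrt 2 / 2 * norm (hermite_scaled x 1)"
      unfolding hermite_scaled_1 by (simp add: norm_mult norm_divide)
    also have "\<dots> \<le> B * norm (hermite_scaled x 1)"
      using B[of 1] assms(1) by simp
    finally show ?thesis
      by (simp add: 0 a_def)
  next
    case (Suc l)
    have "norm x * a (Suc k) = norm (x * hermite_scaled x (l + 1))"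
      by (simp add: a_def Suc norm_mult)
    also have "\<dots> \<le> norm (of_real (sqrt (2 * (real l + 2)) / 2) * hermite_scaled x (l + 2))
        + norm (of_real (sqrt (2 * (real l + 1)) / 2) * hermite_scaled x l)"
      unfolding hermite_scaled_rec by (rule norm_triangle_ineq)
    also have "\<dots> = sqrt (2 * real (l + 2)) / 2 * norm (hermite_scaled x (l + 2))
        + sqrt (2 * real (l + 1)) / 2 * norm (hermite_scaled x l)"
      by (simp add: norm_mult norm_divide add.commute)
    also have "\<dots> \<le> B * norm (hermite_scaled x (l + 2)) + B * norm (hermite_scaled x l)"
    proof (rule add_mono)
      show "sqrt (2 * real (l + 2)) / 2 * norm (hermite_scaled x (l + 2))
          \<le> B * norm (hermite_scaled x (l + 2))"
        using that Suc by (intro B) simp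
      \<comment> \<open>Here l + 1 = k is at most n - 1, so the coefficient itself is
        bounded.\<close>
      have "sqrt (2 * real (l + 1)) \<le> sqrt (2 * real n - 2)"
        using that Suc by simp
      then show "sqrt (2 * real (l + 1)) / 2 * norm (hermite_scaled x l)
          \<le> B * norm (hermite_scaled x l)"
        unfolding B_def by (intro mult_right_mono) simp_all
    qed
    also have "\<dots> = B * (a (k + 2) + a k)"
      by (simp add: a_def Suc algebra_simps)
    finally show ?thesis .
  qed
  have "norm x \<le> 2 * B * cos (pi / (real n + 1))"
  \<comment> \<open>The positive entry is \<open>a 1\<close> = 1, from the constant polynomial of
    degree 0.\<close>
  proof (rule path_subeigenvalue_le[where a = a and j = 0])
    show "a k \<ge> 0" for k
      by (simp add: a_def split: nat.split)
  qed (use assms(1) a_n sub in \<open>simp_all add: a_def\<close>)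
  then show ?thesis
    by (simp add: B_def mult.commute)
qed

end
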